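(* Let $Q:\mathbf{T}\to\mathbb{R}$ be a $C^{3}$ potential such that $Q''\ge\rho-\frac12$ on $\mathbf{T}$ for some $\rho>0$. Then for every smooth probability measure $\mu$ on $\mathbf{T}$, $$\frac{\rho}{2}\,\mathcal{W}_2^{2}(\mu,\mu_Q)\le E_Q(\mu)-E_Q(\mu_Q).$$
   Context: $\mathbf{T}$ is the unit circle in $\mathbb{C}$ and $\alpha$ is the normalized (probability) Haar measure on $\mathbf{T}$. A measure on $\mathbf{T}$ is called smooth if it has a smooth density with respect to $\alpha$. For a differentiable function $\phi$ on $\mathbf{T}$, $\phi'(z)=\frac{d}{dt}\big|_{t=0}\phi(ze^{it})$, and higher derivatives are defined by iterating. For a continuous $Q:\mathbf{T}\to\mathbb{R}$ (a potential) and a probability measure $\mu$ on $\mathbf{T}$, $E_Q(\mu)=\int Q\,d\mu-\iint\log|x-y|\,\mu(dx)\mu(dy)$; $\mu_Q$ denotes the (unique) minimizer of $E_Q$ over probability measures on $\mathbf{T}$. Modified Wasserstein distance: let $\exp(x)=e^{ix}$ for $x\in\mathbb{R}$. For a measure $\mu$ on $\mathbf{T}$ let $\bar\mu$ be the measure on $\mathbb{R}$ given by $\bar\mu(A)=\sum_{n\in\mathbb{Z}}\mu(\exp(A\cap[2n\pi,2(n+1)\pi)))$, and let $\bar\mu_u$ be the restriction of $\bar\mu$ to $[u,u+2\pi)$. For probability measures $\mu,\nu$ on $\mathbf{T}$ and $p\ge1$, $$\mathcal{W}_p(\mu,\nu)=\sup\Big\{W_p(\bar\mu_u,\bar\nu_v):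 u,v\in[0,2\pi],\ \int x\,\bar\mu_u(dx)=\int x\,\bar\nu_v(dx)\Big\},$$ where $W_p$ is the standard $p$-Wasserstein distance on $\mathbb{R}$ (cost $|x-y|^p$, with the power $1/p$), and the supremum over the empty set is $+\infty$. *)

theory Defs
  imports "HOL-Probability.Probability"
begin

abbreviation unit_circle :: "complex set" where
  "unit_circle \<equiv> sphere 0 1"

definition circle_borel :: "complex measure" where
  "circle_borel = restrict_space borel unit_circle"

definition prob_on_circle :: "complex measure \<Rightarrow> bool" where
  "prob_on_circle \<mu> \<longleftrightarrow> prob_space \<mu> \<and> sets \<mu> = sets circle_borel"

text \<open>Normalized Haar measure on the circle, as the law of \<^term>\<open>cis t\<close> for \<open>t\<close> uniform
  on \<open>[0, 2\<pi>)\<close>.\<close>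
definition circle_haar :: "complex measure" where
  "circle_haar = distr (uniform_measure lborel {0..<2 * pi}) circle_borel cis"

definition circle_deriv :: "(complex \<Rightarrow> real) \<Rightarrow> complex \<Rightarrow> real" where
  "circle_deriv \<phi> z = deriv (\<lambda>t. \<phi> (z * cis t)) 0"

text \<open>Only the values of \<open>\<phi>\<close> on the circle matter here.\<close>
definition C_k_on_circle :: "nat \<Rightarrow> (complex \<Rightarrow> real) \<Rightarrow> bool" where
  "C_k_on_circle k \<phi> \<longleftrightarrow>
     (\<forall>j<k. \<forall>z\<in>unit_circle. (\<lambda>t::real. (circle_deriv ^^ j) \<phi> (z * cis t)) differentiable (at 0)) \<and>
     continuous_on unit_circle ((circle_deriv ^^ k) \<phi>)"

definition smooth_on_circle :: "(complex \<Rightarrow> real) \<Rightarrow> bool" where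
  "smooth_on_circle \<phi> \<longleftrightarrow> (\<forall>k. C_k_on_circle k \<phi>)"

definition smooth_measure :: "complex measure \<Rightarrow> bool" where
  "smooth_measure \<mu> \<longleftrightarrow>
     (\<exists>f. smooth_on_circle f \<and> (\<forall>z\<in>unit_circle. 0 \<le> f z) \<and> \<mu> = density circle_haar (\<lambda>z. ennreal (f z)))"

text \<open>The logarithm with the value \<open>-\<infinity>\<close> at 0; the library has \<^prop>\<open>ln (0::real) = 0\<close>.\<close>
definition ext_ln :: "real \<Rightarrow> ereal" where
  "ext_ln r = (if r = 0 then -\<infinity> else ereal (ln r))"

text \<open>Lebesgue integral of an extended real function, meaningful when the positive or the
  negative part has finite integral (\<^const>\<open>e2ennreal\<close> maps negative values to 0).\<close>
definition ext_integral :: "'a measure \<Rightarrow> ('a \<Rightarrow> ereal) \<Rightarrow> ereal" where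
  "ext_integral M f =
     enn2ereal (\<integral>\<^sup>+x. e2ennreal (f x) \<partial>M) - enn2ereal (\<integral>\<^sup>+x. e2ennreal (- f x) \<partial>M)"

text \<open>The logarithmic kernel is at most \<^term>\<open>ln 2\<close> on the circle, so the energy of a probability
  measure is a well-defined element of \<open>(-\<infinity>, \<infinity>]\<close>.\<close>
definition log_energy :: "(complex \<Rightarrow> real) \<Rightarrow> complex measure \<Rightarrow> ereal" where
  "log_energy Q \<mu> =
     ereal (\<integral>x. Q x \<partial>\<mu>) - ext_integral (\<mu> \<Otimes>\<^sub>M \<mu>) (\<lambda>(x, y). ext_ln (cmod (x - y)))"

definition energy_minimizer :: "(complex \<Rightarrow> real) \<Rightarrow> complex measure \<Rightarrow> bool" where
  "energy_minimizer Q \<mu> \<longleftrightarrow>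
     prob_on_circle \<mu> \<and> (\<forall>\<nu>. prob_on_circle \<nu> \<longrightarrow> log_energy Q \<mu> \<le> log_energy Q \<nu>)"

definition couplings :: "real measure \<Rightarrow> real measure \<Rightarrow> (real \<times> real) measure set" where
  "couplings \<mu> \<nu> =
     {\<pi>. sets \<pi> = sets (borel \<Otimes>\<^sub>M borel) \<and> distr \<pi> borel fst = \<mu> \<and> distr \<pi> borel snd = \<nu>}"

definition ennreal_powr :: "ennreal \<Rightarrow> real \<Rightarrow> ennreal" where
  "ennreal_powr c a = (if c = \<top> then \<top> else ennreal (enn2real c powr a))"

definition wasserstein :: "real \<Rightarrow> real measure \<Rightarrow> real measure \<Rightarrow> ennreal" where
  "wasserstein p \<mu> \<nu> =
     ennreal_powr (INF \<pi>\<in>couplings \<mu> \<nu>. \<integral>\<^sup>+(x, y). ennreal (\<bar>x - y\<bar> powr p) \<partial>\<pi>) (1 / p)"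

definition lift_measure :: "complex measure \<Rightarrow> real measure" where
  "lift_measure \<mu> = measure_of UNIV (sets borel)
     (\<lambda>A. \<integral>\<^sup>+n. emeasure \<mu> (cis ` (A \<inter> {2 * of_int n * pi..<2 * (of_int n + 1) * pi}))
            \<partial>count_space (UNIV :: int set))"

text \<open>The restriction of the lift to \<open>[u, u + 2\<pi>)\<close>, kept as a measure on all of the real line.\<close>
definition lift_from :: "complex measure \<Rightarrow> real \<Rightarrow> real measure" where
  "lift_from \<mu> u = density (lift_measure \<mu>) (indicator {u..<u + 2 * pi})"

text \<open>In \<^typ>\<open>ennreal\<close> the supremum of the empty set is 0, whereas here it has to be \<open>\<infinity>\<close>.\<close>
definition circle_wasserstein :: "real \<Rightarrow> complex measure \<Rightarrow> complex measure \<Rightarrow> ennreal" where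
  "circle_wasserstein p \<mu> \<nu> =
     (let S = {wasserstein p (lift_from \<mu> u) (lift_from \<nu> v) | u v.
                 u \<in> {0..2 * pi} \<and> v \<in> {0..2 * pi} \<and>
                 (\<integral>x. x \<partial>lift_from \<mu> u) = (\<integral>x. x \<partial>lift_from \<nu> v)}
      in if S = {} then \<top> else Sup S)"

end

theory Submission
  imports Defs
begin

text \<open>The energy is \<open>\<rho>\<close>-convex along displacement interpolations. Let \<open>X\<close> and \<open>Y\<close> be the
  quantile functions of the lifts of \<open>\<mu>\<^sub>Q\<close> and \<open>\<mu>\<close> to intervals of length \<open>2\<pi>\<close> chosen so that the
  lifts have equal means, and let \<open>Z\<^sub>t = (1 - t) X + t Y\<close>. Monotonicity keeps \<open>\<bar>Z\<^sub>t s - Z\<^sub>t s'\<bar>\<close> in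
  \<open>(0, 2\<pi>)\<close>, where \<open>r \<mapsto> - ln (2 sin (r / 2)) - r\<^sup>2 / 8\<close> is convex. As \<open>X - Y\<close> has mean zero, the double
  integral of \<open>((X - Y) s - (X - Y) s')\<^sup>2\<close> is \<open>2 E (X - Y)\<^sup>2\<close>, so the logarithmic term makes up for the
  \<open>- 1 / 2\<close> in the bound on \<open>Q''\<close>. Since \<open>\<mu>\<^sub>Q\<close> minimizes the energy, comparing it with the law of
  \<open>cis Z\<^sub>t\<close> and letting \<open>t \<rightarrow> 0\<close> yields \<open>\<rho> / 2 * E (X - Y)\<^sup>2 \<le> E\<^sub>Q(\<mu>) - E\<^sub>Q(\<mu>\<^sub>Q)\<close>. Lifts with equal
  means exist by the intermediate value theorem, because \<open>\<mu>\<close> has no atoms.\<close>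

section \<open>Lifts of circle measures\<close>

lemma sets_circle_borelI: "A \<in> sets borel \<Longrightarrow> A \<subseteq> unit_circle \<Longrightarrow> A \<in> sets circle_borel"
  unfolding circle_borel_def by (subst sets_restrict_space_iff) auto

lemma space_circle_borel [simp]: "space circle_borel = unit_circle"
  by (simp add: circle_borel_def space_restrict_space)

lemma measurable_circle_borelI:
  assumes "f \<in> borel_measurable borel"
  shows "f \<in> borel_measurable circle_borel"
  unfolding circle_borel_def using assms by (rule measurable_restrict_space1)

lemma borel_measurable_cis [measurable]: "cis \<in> borel_measurable borel"
  by (intro borel_measurable_continuous_onI continuous_intros)

lemma measurable_cis_circle_borel [measurable]: "cis \<in> borel \<rightarrow>\<^sub>M circle_borel"
  unfolding circle_borel_def by (intro measurable_restrict_space2) auto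

lemma prob_on_circle_space:
  assumes "prob_on_circle \<mu>"
  shows "space \<mu> = unit_circle"
  using assms sets_eq_imp_space_eq[of \<mu> circle_borel] by (simp add: prob_on_circle_def)

lemma borel_measurable_Arg2pi [measurable]: "Arg2pi \<in> borel_measurable borel"
proof -
  have "{z. Arg2pi z \<le> t} \<in> sets borel" for t
    by (intro borel_closed closed_Arg2pi2pi_le)
  then show ?thesis
    by (simp add: borel_measurable_iff_le)
qed

section \<open>Chords and angular coordinates on the circle\<close>

lemma cmod_cis_diff: "cmod (cis x - cis y) = 2 * \<bar>sin ((x - y) / 2)\<bar>"
proof -
  have "(cmod (cis x - cis y))\<^sup>2 = (cos x - cos y)\<^sup>2 + (sin x - sin y)\<^sup>2"
    by (simp add: cmod_power2)
  also have "\<dots> = (sin x)\<^sup>2 + (cos x)\<^sup>2 + ((sin y)\<^sup>2 + (cos y)\<^sup>2) - 2 * (cos x * cos y + sin x * sin y)"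
    by (simp add: power2_eq_square algebra_simps)
  also have "\<dots> = 2 - 2 * cos (x - y)"
    unfolding sin_cos_squared_add by (simp add: cos_diff)
  also have "\<dots> = (2 * sin ((x - y) / 2))\<^sup>2"
    using cos_double_sin[of "(x - y) / 2"] by (simp add: power_mult_distrib diff_divide_distrib)
  finally have "\<bar>cmod (cis x - cis y)\<bar> = \<bar>2 * sin ((x - y) / 2)\<bar>"
    using power2_eq_iff_nonneg real_sqrt_abs by metis
  then show ?thesis
    by (simp add: abs_mult)
qed

lemma cis_inj_short:
  assumes "cis x = cis y" "\<bar>x - y\<bar> < 2 * pi"
  shows "x = y"
proof -
  have s: "sin ((x - y) / 2) = 0"
    using cmod_cis_diff[of x y] assms(1) by simp
  show ?thesis
  proof (rule ccontr)
    assume "x \<noteq> y"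
    then have "sin (\<bar>x - y\<bar> / 2) > 0"
      using assms(2) by (intro sin_gt_zero) auto
    moreover have "sin (\<bar>x - y\<bar> / 2) = 0"
    proof (cases "x \<le> y")
      case True
      have "sin (\<bar>x - y\<bar> / 2) = - sin ((x - y) / 2)"
        unfolding sin_minus[symmetric] using True by (intro arg_cong[where f = sin]) (simp add: field_simps)
      then show ?thesis
        using s by simp
    qed (use s in simp)
    ultimately show False
      by simp
  qed
qed

text \<open>The inverse of \<open>cis\<close> on the window \<open>[u, u + 2 * pi)\<close>: the
  rotation by \<open>cis (- u)\<close> moves the branch cut of \<open>Arg2pi\<close> to the point
  \<open>cis u\<close>.\<close>

definition circle_lift :: "real \<Rightarrow> complex \<Rightarrow> real" where
  "circle_lift u z = u + Arg2pi (z * cis (- u))"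

lemma circle_lift_range: "u \<le> circle_lift u z" "circle_lift u z < u + 2 * pi"
  using Arg2pi[of "z * cis (- u)"] by (auto simp: circle_lift_def)

lemma cis_circle_lift:
  assumes "cmod z = 1"
  shows "cis (circle_lift u z) = z"
proof -
  have "cis (Arg2pi (z * cis (- u))) = z * cis (- u)"
    using complex_norm_eq_1_exp[of "z * cis (- u)"] assms by (simp add: norm_mult cis_conv_exp)
  then have "cis (circle_lift u z) = cis u * (z * cis (- u))"
    by (simp add: circle_lift_def flip: cis_mult)
  then show ?thesis
    by (simp add: cis_mult algebra_simps)
qed

lemma circle_lift_cis:
  assumes "u \<le> x" "x < u + 2 * pi"
  shows "circle_lift u (cis x) = x"
  using assms circle_lift_range[of u "cis x"]
  by (intro cis_inj_short cis_circle_lift) auto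

lemma circle_lift_measurable [measurable]: "circle_lift u \<in> borel_measurable circle_borel"
proof -
  have "(\<lambda>z. z * cis (- u)) \<in> borel_measurable borel"
    by (intro borel_measurable_continuous_onI continuous_intros)
  then show ?thesis
    unfolding circle_lift_def by (intro measurable_circle_borelI) measurable
qed

text \<open>Measurability of a forward image under \<open>cis\<close> is not automatic. Within one
  window it is a preimage under the measurable map \<open>circle_lift u\<close>, which settles the
  question.\<close>

lemma cis_image_eq:
  assumes "B \<subseteq> {u..<u + 2 * pi}"
  shows "cis ` B = circle_lift u -` B \<inter> unit_circle"
proof (intro set_eqI iffI)
  fix z assume "z \<in> cis ` B"
  then obtain x where "x \<in> B" "z = cis x" by auto
  moreover from this have "circle_lift u z = x"
    using assms by (auto intro!: circle_lift_cis)
  ultimately show "z \<in> circle_lift u -` B \<inter> unit_circle"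
    by simp
next
  fix z assume "z \<in> circle_lift u -` B \<inter> unit_circle"
  then show "z \<in> cis ` B"
    using cis_circle_lift[of z u] by (intro image_eqI[of _ _ "circle_lift u z"]) auto
qed

lemma cis_image_sets:
  assumes "B \<in> sets borel" "B \<subseteq> {u..<u + 2 * pi}"
  shows "cis ` B \<in> sets circle_borel"
  using measurable_sets[OF circle_lift_measurable assms(1), of u] cis_image_eq[OF assms(2)]
  by simp

section \<open>The lift of a circle measure as an image measure\<close>

abbreviation period_cell :: "int \<Rightarrow> real set" where
  "period_cell n \<equiv> {2 * of_int n * pi..<2 * (of_int n + 1) * pi}"

lemma period_cell_cover: "\<exists>n. x \<in> period_cell n"
proof
  have "of_int \<lfloor>x / (2 * pi)\<rfloor> * (2 * pi) \<le> x" "x < (of_int \<lfloor>x / (2 * pi)\<rfloor> + 1) * (2 * pi)"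
    using floor_divide_lower[of "2 * pi" x] floor_divide_upper[of "2 * pi" x] by simp_all
  then show "x \<in> period_cell \<lfloor>x / (2 * pi)\<rfloor>"
    by (simp add: algebra_simps)
qed

lemma period_cell_disjoint:
  assumes "x \<in> period_cell m" "x \<in> period_cell n"
  shows "m = n"
proof -
  have "of_int m * (2 * pi) < (of_int n + 1) * (2 * pi)" "of_int n * (2 * pi) < (of_int m + 1) * (2 * pi)"
    using assms by (auto simp: algebra_simps)
  then have "(of_int m :: real) < of_int n + 1" "(of_int n :: real) < of_int m + 1"
    unfolding mult_less_cancel_right by auto
  then show ?thesis
    by linarith
qed

text \<open>\<open>measure_of\<close> returns the prescribed set function only if that function is
  countably additive. This is inherited cell by cell from genuine measures on the line, and the sum
  over the cells commutes with the series.\<close>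

lemma emeasure_lift_measure:
  assumes \<mu>: "prob_on_circle \<mu>" and A: "A \<in> sets borel"
  shows "emeasure (lift_measure \<mu>) A = (\<integral>\<^sup>+n. emeasure \<mu> (cis ` (A \<inter> period_cell n)) \<partial>count_space UNIV)"
proof -
  have sets [measurable_cong]: "sets \<mu> = sets circle_borel"
    using \<mu> by (simp add: prob_on_circle_def)
  \<comment> \<open>The part of the lift on one period cell, written as an image measure of \<mu>;
    its additivity carries over to the summand with index \<open>n\<close>.\<close>
  let ?D = "\<lambda>n::int. density (distr \<mu> borel (circle_lift (2 * of_int n * pi))) (indicator (period_cell n))"
  have eq: "emeasure \<mu> (cis ` (B \<inter> period_cell n)) = emeasure (?D n) B" if "B \<in> sets borel" for B n
  proof -
    have "emeasure (?D n) B = emeasure (distr \<mu> borel (circle_lift (2 * of_int n * pi))) (period_cell n \<inter> B)"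
      using that by (subst emeasure_density) (auto simp: simp flip: indicator_inter_arith)
    also have "\<dots> = emeasure \<mu> (circle_lift (2 * of_int n * pi) -` (period_cell n \<inter> B) \<inter> unit_circle)"
      using that by (subst emeasure_distr) (auto simp: prob_on_circle_space[OF \<mu>])
    also have "\<dots> = emeasure \<mu> (cis ` (period_cell n \<inter> B))"
      by (subst cis_image_eq) (auto simp: algebra_simps)
    finally show ?thesis
      by (simp add: Int_commute)
  qed
  show ?thesis
    unfolding lift_measure_def
  proof (rule emeasure_measure_of_sigma[OF _ _ _ A])
    show "sigma_algebra UNIV (sets borel :: real set set)"
      using sets.sigma_algebra_axioms[of "borel :: real measure"] by simp
    show "positive (sets borel) (\<lambda>A. \<integral>\<^sup>+ n. emeasure \<mu> (cis ` (A \<inter> period_cell n)) \<partial>count_space UNIV)"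
      by (simp add: positive_def)
    show "countably_additive (sets borel) (\<lambda>A. \<integral>\<^sup>+ n. emeasure \<mu> (cis ` (A \<inter> period_cell n)) \<partial>count_space UNIV)"
    proof (rule countably_additiveI)
      fix F :: "nat \<Rightarrow> real set"
      assume F: "range F \<subseteq> sets borel" "disjoint_family F" "(\<Union>i. F i) \<in> sets borel"
      have "(\<Sum>i. \<integral>\<^sup>+ n. emeasure \<mu> (cis ` (F i \<inter> period_cell n)) \<partial>count_space UNIV) =
        (\<integral>\<^sup>+ n. (\<Sum>i. emeasure \<mu> (cis ` (F i \<inter> period_cell n))) \<partial>count_space UNIV)"
        by (rule nn_integral_suminf[symmetric]) simp
      also have "\<dots> = (\<integral>\<^sup>+ n. emeasure \<mu> (cis ` ((\<Union>i. F i) \<inter> period_cell n)) \<partial>count_space UNIV)"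
      proof (rule nn_integral_cong)
        fix n :: int
        have "(\<Sum>i. emeasure \<mu> (cis ` (F i \<inter> period_cell n))) = (\<Sum>i. emeasure (?D n) (F i))"
          using F(1) by (intro suminf_cong eq) auto
        also have "\<dots> = emeasure (?D n) (\<Union>i. F i)"
          using F by (intro suminf_emeasure) auto
        also have "\<dots> = emeasure \<mu> (cis ` ((\<Union>i. F i) \<inter> period_cell n))"
          using F(3) by (rule eq[symmetric])
        finally show "(\<Sum>i. emeasure \<mu> (cis ` (F i \<inter> period_cell n))) = emeasure \<mu> (cis ` ((\<Union>i. F i) \<inter> period_cell n))" .
      qed
      finally show "(\<Sum>i. \<integral>\<^sup>+ n. emeasure \<mu> (cis ` (F i \<inter> period_cell n)) \<partial>count_space UNIV) =
        (\<integral>\<^sup>+ n. emeasure \<mu> (cis ` ((\<Union>i. F i) \<inter> period_cell n)) \<partial>count_space UNIV)" .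
    qed
  qed
qed

lemma sets_lift_measure [measurable_cong]: "sets (lift_measure \<mu>) = sets borel"
  unfolding lift_measure_def using sets.sigma_sets_eq[of "borel :: real measure"] by simp

text \<open>A window of length \<open>2 * pi\<close> is cut by the period cells into disjoint
  pieces. Their images under \<open>cis\<close> are disjoint as well, so the sum over the cells
  collapses to the measure of a single image, which is a preimage under
  \<open>circle_lift u\<close>. From here on only this description of the lift is used.\<close>

lemma lift_from_eq_distr:
  assumes \<mu>: "prob_on_circle \<mu>"
  shows "lift_from \<mu> u = distr \<mu> borel (circle_lift u)"
proof (rule measure_eqI)
  have sets [measurable_cong]: "sets \<mu> = sets circle_borel"
    using \<mu> by (simp add: prob_on_circle_def)
  show "sets (lift_from \<mu> u) = sets (distr \<mu> borel (circle_lift u))"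
    by (simp add: lift_from_def sets_lift_measure)
  fix A assume "A \<in> sets (lift_from \<mu> u)"
  then have A [measurable]: "A \<in> sets borel"
    by (simp add: lift_from_def sets_lift_measure)
  let ?B = "{u..<u + 2 * pi} \<inter> A"
  have "emeasure (lift_from \<mu> u) A = emeasure (lift_measure \<mu>) ?B"
    unfolding lift_from_def
    by (subst emeasure_density) (auto simp: sets_lift_measure simp flip: indicator_inter_arith)
  also have "\<dots> = (\<integral>\<^sup>+n. emeasure \<mu> (cis ` (?B \<inter> period_cell n)) \<partial>count_space UNIV)"
    by (rule emeasure_lift_measure[OF \<mu>]) measurable
  also have "\<dots> = emeasure \<mu> (\<Union>n\<in>UNIV. cis ` (?B \<inter> period_cell n))"
  proof (rule emeasure_UN_countable[symmetric])
    show "cis ` (?B \<inter> period_cell n) \<in> sets \<mu>" for n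
      unfolding sets by (rule cis_image_sets[where u = u]) auto
    show "disjoint_family (\<lambda>n. cis ` (?B \<inter> period_cell n))"
      unfolding disjoint_family_on_def
    proof (intro ballI impI)
      fix m n :: int assume "m \<noteq> n"
      \<comment> \<open>Two points of a half-open window are less than \<open>2 * pi\<close> apart,
        so disjoint pieces have disjoint images.\<close>
      moreover have "inj_on cis ?B"
        by (rule inj_onI, rule cis_inj_short) auto
      ultimately show "cis ` (?B \<inter> period_cell m) \<inter> cis ` (?B \<inter> period_cell n) = {}"
        using period_cell_disjoint unfolding inj_on_def by blast
    qed
  qed auto
  also have "(\<Union>n\<in>UNIV. cis ` (?B \<inter> period_cell n)) = cis ` ?B"
    using period_cell_cover by blast
  also have "\<dots> = circle_lift u -` ?B \<inter> unit_circle"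
    by (rule cis_image_eq) auto
  also have "\<dots> = circle_lift u -` A \<inter> space \<mu>"
    using circle_lift_range[of u] by (auto simp: prob_on_circle_space[OF \<mu>])
  also have "emeasure \<mu> \<dots> = emeasure (distr \<mu> borel (circle_lift u)) A"
    by (subst emeasure_distr) auto
  finally show "emeasure (lift_from \<mu> u) A = emeasure (distr \<mu> borel (circle_lift u)) A" .
qed

lemma distr_cis_lift_from:
  assumes \<mu>: "prob_on_circle \<mu>"
  shows "distr (lift_from \<mu> u) circle_borel cis = \<mu>"
proof -
  have sets [measurable_cong]: "sets \<mu> = sets circle_borel"
    using \<mu> by (simp add: prob_on_circle_def)
  have "distr (lift_from \<mu> u) circle_borel cis = distr \<mu> circle_borel (cis \<circ> circle_lift u)"
    unfolding lift_from_eq_distr[OF \<mu>] by (rule distr_distr) measurable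
  also have "\<dots> = distr \<mu> \<mu> (\<lambda>z. z)"
    by (rule distr_cong) (auto simp: sets prob_on_circle_space[OF \<mu>] cis_circle_lift)
  finally show ?thesis
    by simp
qed

lemma real_distribution_lift_from:
  assumes \<mu>: "prob_on_circle \<mu>"
  shows "real_distribution (lift_from \<mu> u)"
proof -
  have [measurable_cong]: "sets \<mu> = sets circle_borel"
    using \<mu> by (simp add: prob_on_circle_def)
  interpret prob_space \<mu>
    using \<mu> by (simp add: prob_on_circle_def)
  show ?thesis
    unfolding lift_from_eq_distr[OF \<mu>] by (intro real_distribution_distr) measurable
qed

section \<open>Lifts with equal means\<close>

lemma AE_smooth_measure_neq:
  assumes "smooth_measure \<mu>"
  shows "AE z in \<mu>. z \<noteq> w"
proof -
  obtain f where f: "smooth_on_circle f" and \<mu>: "\<mu> = density circle_haar (\<lambda>z. ennreal (f z))"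
    using assms by (auto simp: smooth_measure_def)
  have "continuous_on unit_circle f"
    using f unfolding smooth_on_circle_def C_k_on_circle_def by (metis funpow_0)
  then have [measurable]: "f \<in> borel_measurable circle_haar"
    unfolding circle_haar_def circle_borel_def by (simp add: borel_measurable_continuous_on_restrict)
  have "AE t in uniform_measure lborel {0..<2 * pi}. cis t \<noteq> w"
  proof (rule AE_uniform_measureI)
    \<comment> \<open>The only angle in the interval that \<open>cis\<close> can send to
      \<open>w\<close> is \<open>circle_lift 0 w\<close>, and a single point is Lebesgue
      null.\<close>
    show "AE t in lborel. t \<in> {0..<2 * pi} \<longrightarrow> cis t \<noteq> w"
      using AE_lborel_singleton[of "circle_lift 0 w"]
      by eventually_elim (use circle_lift_cis[of 0] in auto)
  qed simp
  moreover have "{x \<in> space circle_borel. x \<noteq> w} \<in> sets circle_borel"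
    by (intro sets_circle_borelI) auto
  ultimately have "AE z in circle_haar. z \<noteq> w"
    unfolding circle_haar_def by (subst AE_distr_iff) auto
  then show ?thesis
    unfolding \<mu> by (subst AE_density) auto
qed

text \<open>Splits the mean into the drift \<open>u\<close> and an integral that depends on
  \<open>u\<close> only through a rotation; continuity in \<open>u\<close> is thereby reduced to
  that of \<open>Arg2pi\<close> off its branch cut.\<close>

lemma integral_lift_from:
  assumes \<mu>: "prob_on_circle \<mu>"
  shows "(\<integral>x. x \<partial>lift_from \<mu> u) = u + (\<integral>z. Arg2pi (z * cis (- u)) \<partial>\<mu>)"
proof -
  have [measurable_cong]: "sets \<mu> = sets circle_borel"
    using \<mu> by (simp add: prob_on_circle_def)
  interpret prob_space \<mu>
    using \<mu> by (simp add: prob_on_circle_def)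
  have "(\<lambda>z. circle_lift u z - u) \<in> borel_measurable \<mu>"
    by measurable
  then have "integrable \<mu> (\<lambda>z. Arg2pi (z * cis (- u)))"
    using Arg2pi Arg2pi_lt_2pi
    by (intro integrable_const_bound[where B = "2 * pi"]) (auto simp: circle_lift_def less_imp_le)
  moreover have "(\<integral>x. x \<partial>lift_from \<mu> u) = (\<integral>z. circle_lift u z \<partial>\<mu>)"
    unfolding lift_from_eq_distr[OF \<mu>] by (rule integral_distr) auto
  ultimately show ?thesis
    by (simp add: circle_lift_def prob_space)
qed

text \<open>Turning the window once around the circle raises the mean by exactly
  \<open>2 * pi\<close>. For \<mu> this happens continuously, so every value between
  \<open>m \<mu> 0\<close> and \<open>m \<mu> 0 + 2 * pi\<close> is attained. For \<nu> it is enough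
  to look at the two endpoints \<open>v = 0\<close> and \<open>v = 2 * pi\<close>, one of which
  gives a mean in that range.\<close>

lemma exists_equal_means:
  assumes \<mu>: "prob_on_circle \<mu>" and \<nu>: "prob_on_circle \<nu>"
    and atomless: "\<And>w. AE z in \<mu>. z \<noteq> w"
  shows "\<exists>u\<in>{0..2 * pi}. \<exists>v\<in>{0..2 * pi}. (\<integral>x. x \<partial>lift_from \<mu> u) = (\<integral>x. x \<partial>lift_from \<nu> v)"
proof -
  have [measurable_cong]: "sets \<mu> = sets circle_borel" and sp: "space \<mu> = unit_circle"
    using \<mu> prob_on_circle_space by (auto simp: prob_on_circle_def)
  define m where "m = (\<lambda>\<mu> u. \<integral>x. x \<partial>lift_from \<mu> u)"
  have m: "m \<mu> = (\<lambda>u. u + (\<integral>z. Arg2pi (z * cis (- u)) \<partial>\<mu>))" if "prob_on_circle \<mu>" for \<mu>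
    using integral_lift_from[OF that] by (simp add: m_def)
  have bounds: "0 \<le> m \<mu> 0" "m \<mu> 0 \<le> 2 * pi" "m \<mu> (2 * pi) = m \<mu> 0 + 2 * pi" if "prob_on_circle \<mu>" for \<mu>
  proof -
    interpret prob_space \<mu>
      using that by (simp add: prob_on_circle_def)
    show "m \<mu> (2 * pi) = m \<mu> 0 + 2 * pi"
      by (simp add: m[OF that] flip: cis_inverse)
    show "0 \<le> m \<mu> 0"
      by (simp add: m[OF that] Arg2pi_ge_0)
    have "(\<integral>z. Arg2pi z \<partial>\<mu>) \<le> (\<integral>z. 2 * pi \<partial>\<mu>)"
      by (rule integral_mono') (auto simp: Arg2pi_ge_0 Arg2pi_lt_2pi less_imp_le)
    then show "m \<mu> 0 \<le> 2 * pi"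
      by (simp add: m[OF that] prob_space)
  qed
  \<comment> \<open>Dominated convergence with the constant bound \<open>2 * pi\<close>; pointwise
    convergence can fail only at \<open>z = cis u\<close>, which is a null set for \<mu>.\<close>
  have cont: "isCont (\<lambda>u. \<integral>z. Arg2pi (z * cis (- u)) \<partial>\<mu>) u" for u
    unfolding continuous_at_sequentially comp_def
  proof (intro allI impI)
    interpret prob_space \<mu>
      using \<mu> by (simp add: prob_on_circle_def)
    fix r :: "nat \<Rightarrow> real" assume r: "r \<longlonglongrightarrow> u"
    show "(\<lambda>n. \<integral>z. Arg2pi (z * cis (- r n)) \<partial>\<mu>) \<longlonglongrightarrow> (\<integral>z. Arg2pi (z * cis (- u)) \<partial>\<mu>)"
    proof (rule integral_dominated_convergence[where w = "\<lambda>_. 2 * pi"])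
      have "(\<lambda>z. circle_lift u z - u) \<in> borel_measurable \<mu>" for u
        by measurable
      then show "(\<lambda>z. Arg2pi (z * cis (- u))) \<in> borel_measurable \<mu>" 
        "\<And>n. (\<lambda>z. Arg2pi (z * cis (- r n))) \<in> borel_measurable \<mu>"
        by (auto simp: circle_lift_def)
      show "AE z in \<mu>. (\<lambda>n. Arg2pi (z * cis (- r n))) \<longlonglongrightarrow> Arg2pi (z * cis (- u))"
        using atomless[of "cis u"] AE_space
      proof eventually_elim
        case (elim z)
        \<comment> \<open>A point of modulus 1 meets the branch cut of \<open>Arg2pi\<close> only at
          1, which means \<open>z = cis u\<close>.\<close>
        have "z * cis (- u) \<notin> \<real>\<^sub>\<ge>\<^sub>0"
        proof
          assume "z * cis (- u) \<in> \<real>\<^sub>\<ge>\<^sub>0"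
          then obtain a where a: "a \<ge> 0" "z * cis (- u) = of_real a"
            by (auto elim: nonneg_Reals_cases)
          have "cmod (z * cis (- u)) = 1"
            using elim sp by (simp add: norm_mult)
          then have "z * cis (- u) = 1"
            using a by simp
          then have "z * cis (- u) * cis u = cis u"
            by simp
          then show False
            using elim by (simp add: mult.assoc cis_mult)
        qed
        then have "isCont Arg2pi (z * cis (- u))"
          by (rule continuous_at_Arg2pi)
        then show ?case
          by (rule isCont_tendsto_compose) (intro tendsto_intros r)
      qed
    qed (auto simp: Arg2pi_ge_0 Arg2pi_lt_2pi less_imp_le)
  qed
  have IVT: "\<exists>u\<in>{0..2 * pi}. m \<mu> u = c" if "m \<mu> 0 \<le> c" "c \<le> m \<mu> 0 + 2 * pi" for c
  proof -
    have "continuous_on {0..2 * pi} (m \<mu>)"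
      unfolding m[OF \<mu>] using cont
      by (intro continuous_on_add continuous_on_id continuous_at_imp_continuous_on) auto
    then show ?thesis
      using IVT'[of "m \<mu>" 0 c "2 * pi"] that bounds(3)[OF \<mu>] by auto
  qed
  \<comment> \<open>Both starting means lie in \<open>[0, 2 * pi]\<close>. If
    \<open>m \<nu> 0\<close> is below \<open>m \<mu> 0\<close>, adding one full turn brings it into
    the range.\<close>
  have "\<exists>v\<in>{0..2 * pi}. m \<mu> 0 \<le> m \<nu> v \<and> m \<nu> v \<le> m \<mu> 0 + 2 * pi"
  proof (cases "m \<mu> 0 \<le> m \<nu> 0")
    case True
    then show ?thesis
      using bounds[OF \<mu>] bounds[OF \<nu>] by (intro bexI[of _ 0]) auto
  next
    case False
    then show ?thesis
      using bounds[OF \<mu>] bounds[OF \<nu>] by (intro bexI[of _ "2 * pi"]) auto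
  qed
  then show ?thesis
    using IVT unfolding m_def by blast
qed

section \<open>The logarithmic energy\<close>

abbreviation log_kernel :: "complex \<times> complex \<Rightarrow> real" where
  "log_kernel p \<equiv> ln (cmod (fst p - snd p))"

lemma measurable_fst_snd_circle [measurable]:
  "fst \<in> borel_measurable (circle_borel \<Otimes>\<^sub>M circle_borel)"
  "snd \<in> borel_measurable (circle_borel \<Otimes>\<^sub>M circle_borel)"
proof -
  have "(\<lambda>z. z) \<in> borel_measurable circle_borel"
    by (rule measurable_circle_borelI) simp
  then show "fst \<in> borel_measurable (circle_borel \<Otimes>\<^sub>M circle_borel)"
    "snd \<in> borel_measurable (circle_borel \<Otimes>\<^sub>M circle_borel)"
    by (auto intro: measurable_compose[OF measurable_fst] measurable_compose[OF measurable_snd])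
qed

text \<open>\<open>ext_ln\<close> and \<open>ln\<close> differ only at 0, that is on the diagonal,
  which is assumed null. Integrability then makes both parts of \<open>ext_integral\<close> finite,
  and their difference is the Bochner integral.\<close>

lemma log_energy_eq:
  assumes \<mu>: "prob_on_circle \<mu>"
    and ne: "AE p in \<mu> \<Otimes>\<^sub>M \<mu>. fst p \<noteq> snd p" and int: "integrable (\<mu> \<Otimes>\<^sub>M \<mu>) log_kernel"
  shows "log_energy Q \<mu> = ereal ((\<integral>x. Q x \<partial>\<mu>) - (\<integral>p. log_kernel p \<partial>(\<mu> \<Otimes>\<^sub>M \<mu>)))"
proof -
  let ?k = "\<lambda>(x, y). ext_ln (cmod (x - y))" and ?M = "\<mu> \<Otimes>\<^sub>M \<mu>"
  have pos: "(\<integral>\<^sup>+p. e2ennreal (?k p) \<partial>?M) = (\<integral>\<^sup>+p. ennreal (log_kernel p) \<partial>?M)"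
    by (rule nn_integral_cong_AE, use ne in eventually_elim) (auto simp: ext_ln_def)
  have neg: "(\<integral>\<^sup>+p. e2ennreal (- ?k p) \<partial>?M) = (\<integral>\<^sup>+p. ennreal (- log_kernel p) \<partial>?M)"
    by (rule nn_integral_cong_AE, use ne in eventually_elim) (auto simp: ext_ln_def)
  have fin: "(\<integral>\<^sup>+p. ennreal (log_kernel p) \<partial>?M) \<noteq> \<infinity>" "(\<integral>\<^sup>+p. ennreal (- log_kernel p) \<partial>?M) \<noteq> \<infinity>"
    using int by (auto simp: real_integrable_def)
  have "ext_integral ?M ?k = ereal (\<integral>p. log_kernel p \<partial>?M)"
    unfolding ext_integral_def pos neg real_lebesgue_integral_def[OF int] using fin
    by (cases "\<integral>\<^sup>+p. ennreal (log_kernel p) \<partial>?M"; cases "\<integral>\<^sup>+p. ennreal (- log_kernel p) \<partial>?M") auto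
  then show ?thesis
    by (simp add: log_energy_def)
qed

lemma ext_ln_chord_le:
  assumes "x \<in> unit_circle" "y \<in> unit_circle"
  shows "e2ennreal (ext_ln (cmod (x - y))) \<le> ennreal (ln 2)"
proof (cases "x = y")
  case False
  moreover have "cmod (x - y) \<le> 2"
    using assms norm_triangle_ineq4[of x y] by simp
  ultimately show ?thesis
    by (auto simp: ext_ln_def intro!: ennreal_leI)
qed (simp add: ext_ln_def e2ennreal_neg)

text \<open>The positive part of the kernel is bounded by \<open>ln 2\<close>, so finite energy
  forces the negative part to have a finite integral. Since that part is infinite on the diagonal,
  the diagonal is null.\<close>

lemma log_energy_finiteD:
  assumes \<mu>: "prob_on_circle \<mu>" and fin: "log_energy Q \<mu> \<noteq> \<infinity>"
  shows "AE p in \<mu> \<Otimes>\<^sub>M \<mu>. fst p \<noteq> snd p" "integrable (\<mu> \<Otimes>\<^sub>M \<mu>) log_kernel"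
proof -
  let ?k = "\<lambda>(x, y). ext_ln (cmod (x - y))" and ?M = "\<mu> \<Otimes>\<^sub>M \<mu>"
  have [measurable_cong]: "sets \<mu> = sets circle_borel"
    using \<mu> by (simp add: prob_on_circle_def)
  interpret \<mu>: prob_space \<mu>
    using \<mu> by (simp add: prob_on_circle_def)
  interpret pair_prob_space \<mu> \<mu> ..
  have space: "space ?M = unit_circle \<times> unit_circle"
    by (simp add: space_pair_measure prob_on_circle_space[OF \<mu>])
  have k_eq: "?k = (\<lambda>p. if cmod (fst p - snd p) = 0 then - \<infinity> else ereal (log_kernel p))"
    by (auto simp: ext_ln_def)
  have meas [measurable]: "?k \<in> borel_measurable ?M"
    unfolding k_eq by measurable
  have "(\<integral>\<^sup>+p. e2ennreal (?k p) \<partial>?M) \<le> (\<integral>\<^sup>+p. ennreal (ln 2) \<partial>?M)"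
    using ext_ln_chord_le by (intro nn_integral_mono) (auto simp: space)
  also have "\<dots> < \<infinity>"
    by (simp add: emeasure_space_1)
  finally have pos: "(\<integral>\<^sup>+p. e2ennreal (?k p) \<partial>?M) < \<infinity>" .
  \<comment> \<open>A finite positive part minus an infinite negative part is minus infinity in
    \<open>ext_integral\<close>, and the energy subtracts this.\<close>
  have neg: "(\<integral>\<^sup>+p. e2ennreal (- ?k p) \<partial>?M) \<noteq> \<infinity>"
  proof
    assume "(\<integral>\<^sup>+p. e2ennreal (- ?k p) \<partial>?M) = \<infinity>"
    then have "ext_integral ?M ?k = - \<infinity>"
      unfolding ext_integral_def using pos by (cases "\<integral>\<^sup>+p. e2ennreal (?k p) \<partial>?M") auto
    then show False
      using fin by (simp add: log_energy_def)
  qed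
  have "AE p in ?M. e2ennreal (- ?k p) \<noteq> \<infinity>"
    using neg by (intro nn_integral_PInf_AE) auto
  then show ne: "AE p in ?M. fst p \<noteq> snd p"
    by eventually_elim (auto simp: ext_ln_def)
  have "(\<integral>\<^sup>+p. ennreal (log_kernel p) \<partial>?M) = (\<integral>\<^sup>+p. e2ennreal (?k p) \<partial>?M)"
    by (rule nn_integral_cong_AE, use ne in eventually_elim) (auto simp: ext_ln_def)
  moreover have "(\<integral>\<^sup>+p. ennreal (- log_kernel p) \<partial>?M) = (\<integral>\<^sup>+p. e2ennreal (- ?k p) \<partial>?M)"
    by (rule nn_integral_cong_AE, use ne in eventually_elim) (auto simp: ext_ln_def)
  ultimately show "integrable ?M log_kernel"
    using pos neg by (simp add: real_integrable_def)
qed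

section \<open>Convexity of the logarithmic kernel\<close>

lemma log_chord_eq:
  assumes "0 < \<bar>x - y\<bar>" "\<bar>x - y\<bar> < 2 * pi"
  shows "ln (cmod (cis x - cis y)) = ln (2 * sin (\<bar>x - y\<bar> / 2))"
proof -
  have "sin (\<bar>x - y\<bar> / 2) > 0"
    using assms by (intro sin_gt_zero) auto
  moreover have "\<bar>sin ((x - y) / 2)\<bar> = \<bar>sin (\<bar>x - y\<bar> / 2)\<bar>"
    using sin_minus[of "(x - y) / 2"] by (cases "x \<le> y") (auto simp: diff_divide_distrib)
  ultimately show ?thesis
    by (simp add: cmod_cis_diff)
qed

text \<open>The logarithmic kernel alone contributes \<open>1 / 4\<close> of convexity, since
  \<open>(- ln (sin (r / 2)))'' = 1 / (4 (sin (r / 2))\<^sup>2)\<close>.\<close>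
lemma convex_on_neg_ln_sin:
  "convex_on {0<..<2 * pi} (\<lambda>r::real. - ln (2 * sin (r / 2)) - r\<^sup>2 / 8)"
proof (rule f''_ge0_imp_convex)
  fix r :: real assume r: "r \<in> {0<..<2 * pi}"
  have s: "sin (r / 2) > 0"
    using r by (intro sin_gt_zero) auto
  show "((\<lambda>r. - ln (2 * sin (r / 2)) - r\<^sup>2 / 8) has_real_derivative
      - (cos (r / 2) / (2 * sin (r / 2))) - r / 4) (at r)"
    using s by (auto intro!: derivative_eq_intros simp: field_simps)
  show "((\<lambda>r. - (cos (r / 2) / (2 * sin (r / 2))) - r / 4) has_real_derivative
      1 / (4 * (sin (r / 2))\<^sup>2) - 1 / 4) (at r)"
    using s sin_cos_squared_add3[of "r / 2"]
    by (auto intro!: derivative_eq_intros simp: field_simps power2_eq_square)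
  have "(sin (r / 2))\<^sup>2 \<le> 1"
    by (simp add: abs_square_le_1)
  then show "0 \<le> 1 / (4 * (sin (r / 2))\<^sup>2) - 1 / 4"
    using s by (simp add: field_simps)
qed simp

text \<open>Because \<open>a - a'\<close> and \<open>b - b'\<close> have the same sign, the distance
  of the interpolated angles is the same convex combination of the distances \<open>r\<close> and
  \<open>s\<close>, and the two displacements differ by \<open>r - s\<close> up to sign. Convexity
  of the corrected kernel applies at \<open>r\<close> and \<open>s\<close>; the defect of the
  quadratic correction is the last term.\<close>

lemma log_chord_interpolate:
  fixes a a' b b' t :: real
  assumes t: "0 \<le> t" "t \<le> 1" and same: "(a - a') * (b - b') > 0"
    and short: "\<bar>a - a'\<bar> < 2 * pi" "\<bar>b - b'\<bar> < 2 * pi"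
  defines "z \<equiv> (1 - t) * a + t * b" and "z' \<equiv> (1 - t) * a' + t * b'"
  shows "0 < \<bar>z - z'\<bar>" "\<bar>z - z'\<bar> < 2 * pi"
    "ln (cmod (cis z - cis z')) \<ge> (1 - t) * ln (cmod (cis a - cis a')) + t * ln (cmod (cis b - cis b'))
       + t * (1 - t) / 8 * ((a - b) - (a' - b'))\<^sup>2"
proof -
  define r where "r = \<bar>a - a'\<bar>"
  define s where "s = \<bar>b - b'\<bar>"
  have r: "r \<in> {0<..<2 * pi}" and s: "s \<in> {0<..<2 * pi}"
    using same short by (auto simp: r_def s_def)
  have zz: "z - z' = (1 - t) * (a - a') + t * (b - b')"
    by (simp add: z_def z'_def algebra_simps)
  have abs: "\<bar>z - z'\<bar> = (1 - t) * r + t * s \<and> ((a - b) - (a' - b'))\<^sup>2 = (r - s)\<^sup>2"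
  proof (cases "a - a' > 0")
    case True
    with same have "b - b' > 0"
      by (simp add: zero_less_mult_iff)
    with True have rs: "r = a - a'" "s = b - b'"
      by (auto simp: r_def s_def)
    have "z - z' = (1 - t) * r + t * s"
      unfolding zz rs ..
    moreover have "(1 - t) * r + t * s \<ge> 0"
      using t r s by auto
    moreover have "(a - b) - (a' - b') = r - s"
      by (simp add: rs)
    ultimately show ?thesis
      by simp
  next
    case False
    with same have neg: "a - a' < 0" "b - b' < 0"
      by (auto simp: zero_less_mult_iff)
    then have rs: "r = - (a - a')" "s = - (b - b')"
      by (auto simp: r_def s_def)
    have "z - z' = - ((1 - t) * r + t * s)"
      unfolding zz rs by (simp add: algebra_simps)
    moreover have "(1 - t) * r + t * s \<ge> 0"
      using t r s by auto
    moreover have "(a - b) - (a' - b') = s - r"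
      by (simp add: rs)
    ultimately show ?thesis
      by (simp add: power2_commute)
  qed
  have mem: "(1 - t) * r + t * s \<in> {0<..<2 * pi}"
    using convexD[OF convex_real_interval(8), of r 0 "2 * pi" s "1 - t" t] r s t by simp
  then show *: "0 < \<bar>z - z'\<bar>" "\<bar>z - z'\<bar> < 2 * pi"
    using abs by auto
  have "- ln (2 * sin (((1 - t) * r + t * s) / 2)) - ((1 - t) * r + t * s)\<^sup>2 / 8
      \<le> (1 - t) * (- ln (2 * sin (r / 2)) - r\<^sup>2 / 8) + t * (- ln (2 * sin (s / 2)) - s\<^sup>2 / 8)"
    using convex_onD[OF convex_on_neg_ln_sin t r s] by simp
  moreover have "(1 - t) * (r\<^sup>2 / 8) + t * (s\<^sup>2 / 8) - ((1 - t) * r + t * s)\<^sup>2 / 8 = t * (1 - t) / 8 * (r - s)\<^sup>2"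
    by (simp add: power2_eq_square field_simps)
  moreover have "(1 - t) * (- ln (2 * sin (r / 2)) - r\<^sup>2 / 8) + t * (- ln (2 * sin (s / 2)) - s\<^sup>2 / 8) =
      - ((1 - t) * ln (2 * sin (r / 2))) - t * ln (2 * sin (s / 2)) - ((1 - t) * (r\<^sup>2 / 8) + t * (s\<^sup>2 / 8))"
    by (simp add: algebra_simps)
  ultimately have "ln (2 * sin (((1 - t) * r + t * s) / 2)) \<ge>
      (1 - t) * ln (2 * sin (r / 2)) + t * ln (2 * sin (s / 2)) + t * (1 - t) / 8 * (r - s)\<^sup>2"
    by linarith
  then show "ln (cmod (cis z - cis z')) \<ge> (1 - t) * ln (cmod (cis a - cis a')) + t * ln (cmod (cis b - cis b'))
       + t * (1 - t) / 8 * ((a - b) - (a' - b'))\<^sup>2"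
    using abs log_chord_eq[OF *] log_chord_eq[of a a'] log_chord_eq[of b b'] r s
    by (simp add: r_def s_def)
qed

section \<open>The potential as a function of the angle\<close>

lemma circle_deriv_has_derivative:
  assumes "(\<lambda>t::real. \<phi> (cis x * cis t)) differentiable (at 0)"
  shows "((\<lambda>x. \<phi> (cis x)) has_real_derivative circle_deriv \<phi> (cis x)) (at x)"
proof -
  have "((\<lambda>t. \<phi> (cis x * cis t)) has_real_derivative circle_deriv \<phi> (cis x)) (at 0)"
    using assms unfolding circle_deriv_def
    by (simp add: DERIV_deriv_iff_real_differentiable)
  \<comment> \<open>Multiplication by \<open>cis t\<close> translates the angle, so the derivative
    along rotations is an ordinary derivative at a shifted point.\<close>
  then have "((\<lambda>t. \<phi> (cis (t + x))) has_real_derivative circle_deriv \<phi> (cis x)) (at 0)"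
    by (simp add: cis_mult add.commute)
  then show ?thesis
    using DERIV_shift[of "\<lambda>x. \<phi> (cis x)" _ 0 x] by simp
qed

lemma C_k_on_circle_deriv:
  assumes "C_k_on_circle k \<phi>" "j < k"
  shows "((\<lambda>x. (circle_deriv ^^ j) \<phi> (cis x)) has_real_derivative (circle_deriv ^^ Suc j) \<phi> (cis x)) (at x)"
  using assms circle_deriv_has_derivative[of "(circle_deriv ^^ j) \<phi>" x]
  by (auto simp: C_k_on_circle_def)

text \<open>The quadratic correction is not periodic, so convexity is expressed for the lift of
  \<open>Q\<close> to the real line.\<close>

lemma convex_on_potential:
  assumes "C_k_on_circle k Q" "k \<ge> 2" and Q2: "\<forall>z\<in>unit_circle. (circle_deriv ^^ 2) Q z \<ge> c"
  shows "convex_on UNIV (\<lambda>x. Q (cis x) - c / 2 * x\<^sup>2)"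
proof (rule f''_ge0_imp_convex)
  fix x :: real
  show "((\<lambda>x. Q (cis x) - c / 2 * x\<^sup>2) has_real_derivative circle_deriv Q (cis x) - c * x) (at x)"
    using C_k_on_circle_deriv[OF assms(1), of 0 x] assms(2) by (auto intro!: derivative_eq_intros)
  show "((\<lambda>x. circle_deriv Q (cis x) - c * x) has_real_derivative (circle_deriv ^^ 2) Q (cis x) - c) (at x)"
    using C_k_on_circle_deriv[OF assms(1), of 1 x] assms(2) 
    by (auto intro!: derivative_eq_intros simp: numeral_2_eq_2)
  show "0 \<le> (circle_deriv ^^ 2) Q (cis x) - c"
    using Q2 by simp
qed simp

text \<open>The gap between the interpolated squares and the square of the interpolation is
  \<open>t * (1 - t) * (a - b)\<^sup>2\<close>. The constant \<open>c\<close> may have either sign,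
  as it must for \<open>c = \<rho> - 1 / 2\<close>.\<close>

lemma potential_interpolate:
  assumes conv: "convex_on UNIV (\<lambda>x. Q (cis x) - c / 2 * x\<^sup>2)" and t: "0 \<le> t" "t \<le> 1"
  shows "Q (cis ((1 - t) * a + t * b)) \<le> (1 - t) * Q (cis a) + t * Q (cis b) - t * (1 - t) * (c / 2) * (a - b)\<^sup>2"
proof -
  have "Q (cis ((1 - t) * a + t * b)) - c / 2 * ((1 - t) * a + t * b)\<^sup>2
      \<le> (1 - t) * (Q (cis a) - c / 2 * a\<^sup>2) + t * (Q (cis b) - c / 2 * b\<^sup>2)"
    using convex_onD[OF conv t, of a b] by simp
  moreover have "c / 2 * ((1 - t) * a + t * b)\<^sup>2 - (1 - t) * (c / 2 * a\<^sup>2) - t * (c / 2 * b\<^sup>2)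
     = - (t * (1 - t) * (c / 2) * (a - b)\<^sup>2)"
    by (simp add: power2_eq_square field_simps)
  ultimately show ?thesis
    by (simp add: algebra_simps)
qed

lemma C_k_on_circle_continuous:
  assumes "C_k_on_circle k Q" "k > 0"
  shows "continuous_on UNIV (\<lambda>x. Q (cis x))"
  using C_k_on_circle_deriv[OF assms(1), of 0] assms(2)
  by (auto intro!: continuous_at_imp_continuous_on DERIV_isCont)

lemma C_k_on_circle_measurable:
  assumes "C_k_on_circle k Q" "k > 0"
  shows "Q \<in> borel_measurable circle_borel"
proof -
  have [measurable]: "(\<lambda>x. Q (cis x)) \<in> borel_measurable borel"
    by (intro borel_measurable_continuous_onI C_k_on_circle_continuous[OF assms])
  have "(\<lambda>z. Q (cis (circle_lift 0 z))) \<in> borel_measurable circle_borel"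
    by measurable
  then show ?thesis
    by (subst (asm) measurable_cong[where g = Q]) (auto simp: cis_circle_lift)
qed

lemma C_k_on_circle_bounded:
  assumes "C_k_on_circle k Q" "k > 0"
  shows "\<exists>B. \<forall>z\<in>unit_circle. \<bar>Q z\<bar> \<le> B"
proof -
  have "bounded ((\<lambda>x. Q (cis x)) ` {0..2 * pi})"
    by (intro compact_imp_bounded compact_continuous_image continuous_on_subset[OF C_k_on_circle_continuous[OF assms]]) auto
  then obtain B where B: "\<forall>x\<in>{0..2 * pi}. \<bar>Q (cis x)\<bar> \<le> B"
    unfolding bounded_iff by auto
  have "\<bar>Q z\<bar> \<le> B" if "z \<in> unit_circle" for z
    using B[rule_format, of "circle_lift 0 z"] circle_lift_range[of 0 z] that by (simp add: cis_circle_lift)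
  then show ?thesis
    by blast
qed

section \<open>Convexity along interpolations\<close>

context prob_space
begin

text \<open>Measures are represented by random angles on a common probability space, so that
  interpolating between two of them becomes a pointwise operation.\<close>

abbreviation circle_law :: "('a \<Rightarrow> real) \<Rightarrow> complex measure" where
  "circle_law Z \<equiv> distr M circle_borel (\<lambda>s. cis (Z s))"

abbreviation log_chord :: "('a \<Rightarrow> real) \<Rightarrow> 'a \<times> 'a \<Rightarrow> real" where
  "log_chord Z p \<equiv> ln (cmod (cis (Z (fst p)) - cis (Z (snd p))))"

lemma prob_on_circle_law:
  assumes [measurable]: "Z \<in> borel_measurable M"
  shows "prob_on_circle (circle_law Z)"
  unfolding prob_on_circle_def by (auto intro!: prob_space_distr)

lemma circle_law_pair:
  assumes [measurable]: "Z \<in> borel_measurable M"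
  shows "circle_law Z \<Otimes>\<^sub>M circle_law Z =
    distr (M \<Otimes>\<^sub>M M) (circle_borel \<Otimes>\<^sub>M circle_borel) (\<lambda>(x, y). (cis (Z x), cis (Z y)))"
proof (rule pair_measure_distr)
  interpret law: prob_space "circle_law Z"
    by (rule prob_space_distr) measurable
  show "sigma_finite_measure (circle_law Z)"
    by unfold_locales
qed measurable

lemma log_energy_circle_law:
  assumes [measurable]: "Z \<in> borel_measurable M" "Q \<in> borel_measurable circle_borel"
    and "AE p in M \<Otimes>\<^sub>M M. cis (Z (fst p)) \<noteq> cis (Z (snd p))" "integrable (M \<Otimes>\<^sub>M M) (log_chord Z)"
  shows "log_energy Q (circle_law Z) =
    ereal ((\<integral>s. Q (cis (Z s)) \<partial>M) - (\<integral>p. log_chord Z p \<partial>(M \<Otimes>\<^sub>M M)))"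
proof (subst log_energy_eq)
  let ?g = "\<lambda>(x, y). (cis (Z x), cis (Z y))"
  have [measurable]: "log_kernel \<in> borel_measurable (circle_borel \<Otimes>\<^sub>M circle_borel)"
    by measurable
  have [measurable]: "?g \<in> M \<Otimes>\<^sub>M M \<rightarrow>\<^sub>M circle_borel \<Otimes>\<^sub>M circle_borel"
    by measurable
  show "AE p in circle_law Z \<Otimes>\<^sub>M circle_law Z. fst p \<noteq> snd p"
    unfolding circle_law_pair[OF assms(1)] using assms(3)
    by (subst AE_distr_iff) (auto simp: case_prod_beta)
  show "integrable (circle_law Z \<Otimes>\<^sub>M circle_law Z) log_kernel"
    unfolding circle_law_pair[OF assms(1)] using assms(4)
    by (subst integrable_distr_eq) (auto simp: case_prod_beta)
  have "(\<integral>p. log_kernel p \<partial>(circle_law Z \<Otimes>\<^sub>M circle_law Z)) = (\<integral>p. log_chord Z p \<partial>(M \<Otimes>\<^sub>M M))"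
    unfolding circle_law_pair[OF assms(1)]
    by (subst integral_distr) (auto simp: case_prod_beta)
  moreover have "(\<integral>z. Q z \<partial>circle_law Z) = (\<integral>s. Q (cis (Z s)) \<partial>M)"
    by (rule integral_distr) measurable
  ultimately show "ereal ((\<integral>z. Q z \<partial>circle_law Z) - (\<integral>p. log_kernel p \<partial>(circle_law Z \<Otimes>\<^sub>M circle_law Z))) =
      ereal ((\<integral>s. Q (cis (Z s)) \<partial>M) - (\<integral>p. log_chord Z p \<partial>(M \<Otimes>\<^sub>M M)))"
    by simp
qed (rule prob_on_circle_law, fact)

lemma log_energy_circle_law_finiteD:
  assumes [measurable]: "Z \<in> borel_measurable M" and fin: "log_energy Q (circle_law Z) \<noteq> \<infinity>"
  shows "AE p in M \<Otimes>\<^sub>M M. cis (Z (fst p)) \<noteq> cis (Z (snd p))" "integrable (M \<Otimes>\<^sub>M M) (log_chord Z)"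
proof -
  let ?g = "\<lambda>(x, y). (cis (Z x), cis (Z y))"
  have [measurable]: "log_kernel \<in> borel_measurable (circle_borel \<Otimes>\<^sub>M circle_borel)"
    by measurable
  have [measurable]: "?g \<in> M \<Otimes>\<^sub>M M \<rightarrow>\<^sub>M circle_borel \<Otimes>\<^sub>M circle_borel"
    by measurable
  note * = log_energy_finiteD[OF prob_on_circle_law[OF assms(1)] fin]
  show "AE p in M \<Otimes>\<^sub>M M. cis (Z (fst p)) \<noteq> cis (Z (snd p))"
    using *(1) unfolding circle_law_pair[OF assms(1)]
    by (subst (asm) AE_distr_iff) (auto simp: case_prod_beta)
  show "integrable (M \<Otimes>\<^sub>M M) (log_chord Z)"
    using *(2) unfolding circle_law_pair[OF assms(1)]
    by (subst (asm) integrable_distr_eq) (auto simp: case_prod_beta)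
qed

text \<open>Expanding the square leaves a cross term that is a multiple of the squared mean, hence
  zero. This is where equality of the means of the two lifts enters.\<close>

lemma integral_pair_diff_square:
  fixes d :: "'a \<Rightarrow> real"
  assumes [measurable]: "d \<in> borel_measurable M"
    and bound: "\<And>s. s \<in> space M \<Longrightarrow> \<bar>d s\<bar> \<le> B" and mean: "expectation d = 0"
  shows "integrable (M \<Otimes>\<^sub>M M) (\<lambda>p. (d (fst p) - d (snd p))\<^sup>2)"
    "(\<integral>p. (d (fst p) - d (snd p))\<^sup>2 \<partial>(M \<Otimes>\<^sub>M M)) = 2 * expectation (\<lambda>s. (d s)\<^sup>2)"
proof -
  have "integrable M d"
    using bound by (intro integrable_const_bound[where B = B] AE_I2) auto
  moreover have "integrable M (\<lambda>s. (d s)\<^sup>2)"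
    using bound by (intro integrable_const_bound[where B = "B\<^sup>2"] AE_I2)
      (auto intro!: abs_le_square_iff[THEN iffD1] order_trans[OF bound abs_ge_self])
  ultimately have int: "integrable M d" "integrable M (\<lambda>s. (d s)\<^sup>2)"
    by auto
  note total_one = prob_space
  interpret pair_prob_space M M ..
  show pint: "integrable (M \<Otimes>\<^sub>M M) (\<lambda>p. (d (fst p) - d (snd p))\<^sup>2)"
  proof (rule P.integrable_const_bound[where B = "(2 * B)\<^sup>2"])
    have "(d x - d y)\<^sup>2 \<le> (2 * B)\<^sup>2" if "x \<in> space M" "y \<in> space M" for x y
      using bound[OF that(1)] bound[OF that(2)] by (intro abs_le_square_iff[THEN iffD1]) linarith
    then show "AE p in M \<Otimes>\<^sub>M M. norm ((d (fst p) - d (snd p))\<^sup>2) \<le> (2 * B)\<^sup>2"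
      by (intro AE_I2) (auto simp: space_pair_measure)
  qed measurable
  have "(\<integral>p. (d (fst p) - d (snd p))\<^sup>2 \<partial>(M \<Otimes>\<^sub>M M)) = (\<integral>x. \<integral>y. (d x - d y)\<^sup>2 \<partial>M \<partial>M)"
    using integral_fst'[OF pint] by simp
  also have "\<dots> = (\<integral>x. (d x)\<^sup>2 + (\<integral>s. (d s)\<^sup>2 \<partial>M) \<partial>M)"
    using int mean by (simp add: power2_diff total_one)
  finally show "(\<integral>p. (d (fst p) - d (snd p))\<^sup>2 \<partial>(M \<Otimes>\<^sub>M M)) = 2 * (\<integral>s. (d s)\<^sup>2 \<partial>M)"
    using int by (simp add: total_one)
qed

text \<open>Two gains of order \<open>t * (1 - t)\<close> add up. The potential gives the factor
  \<open>(\<rho> - 1 / 2) / 2\<close>, the logarithm gives \<open>1 / 4\<close>, and the sum is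
  \<open>\<rho> / 2\<close>.\<close>

lemma log_energy_interpolate:
  fixes X Y :: "'a \<Rightarrow> real" and u v t \<rho> :: real
  assumes [measurable]: "X \<in> borel_measurable M" "Y \<in> borel_measurable M" "Q \<in> borel_measurable circle_borel"
    and bX: "\<And>s. s \<in> space M \<Longrightarrow> X s \<in> {u..u + 2 * pi}"
    and bY: "\<And>s. s \<in> space M \<Longrightarrow> Y s \<in> {v..v + 2 * pi}"
    and mono: "\<And>s s'. s \<in> space M \<Longrightarrow> s' \<in> space M \<Longrightarrow> (X s - X s') * (Y s - Y s') \<ge> 0"
    and mean: "expectation X = expectation Y"
    and Qb: "\<And>z. z \<in> unit_circle \<Longrightarrow> \<bar>Q z\<bar> \<le> B"
    and conv: "convex_on UNIV (\<lambda>x. Q (cis x) - (\<rho> - 1 / 2) / 2 * x\<^sup>2)"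
    and t: "0 \<le> t" "t \<le> 1"
    and eX: "log_energy Q (circle_law X) = ereal a" and eY: "log_energy Q (circle_law Y) = ereal b"
  shows "log_energy Q (circle_law (\<lambda>s. (1 - t) * X s + t * Y s))
    \<le> ereal ((1 - t) * a + t * b - \<rho> / 2 * t * (1 - t) * expectation (\<lambda>s. (X s - Y s)\<^sup>2))"
proof -
  define Z where "Z = (\<lambda>s. (1 - t) * X s + t * Y s)"
  define d where "d = (\<lambda>s. X s - Y s)"
  have [measurable]: "Z \<in> borel_measurable M" "d \<in> borel_measurable M"
    by (auto simp: Z_def d_def)
  note X = log_energy_circle_law_finiteD[OF assms(1), of Q, unfolded eX, simplified]
  note Y = log_energy_circle_law_finiteD[OF assms(2), of Q, unfolded eY, simplified]
  have a: "a = expectation (\<lambda>s. Q (cis (X s))) - (\<integral>p. log_chord X p \<partial>(M \<Otimes>\<^sub>M M))"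
    using log_energy_circle_law[OF assms(1,3) X] eX by simp
  have b: "b = expectation (\<lambda>s. Q (cis (Y s))) - (\<integral>p. log_chord Y p \<partial>(M \<Otimes>\<^sub>M M))"
    using log_energy_circle_law[OF assms(2,3) Y] eY by simp
  have iX: "integrable M X"
    using bX by (intro integrable_const_bound[where B = "\<bar>u\<bar> + 2 * pi"] AE_I2) (force simp: abs_le_iff)+
  have iY: "integrable M Y"
    using bY by (intro integrable_const_bound[where B = "\<bar>v\<bar> + 2 * pi"] AE_I2) (force simp: abs_le_iff)+
  have d0: "expectation d = 0"
    unfolding d_def using iX iY mean by simp
  have db: "\<bar>d s\<bar> \<le> \<bar>u - v\<bar> + 2 * pi" if "s \<in> space M" for s
    using bX[OF that] bY[OF that] by (auto simp: d_def)
  have id2: "integrable M (\<lambda>s. (d s)\<^sup>2)"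
    using db by (intro integrable_const_bound[where B = "(\<bar>u - v\<bar> + 2 * pi)\<^sup>2"] AE_I2)
      (auto intro!: abs_le_square_iff[THEN iffD1])
  note dd = integral_pair_diff_square[OF \<open>d \<in> borel_measurable M\<close> db d0]

  have "AE p in M \<Otimes>\<^sub>M M. cis (Z (fst p)) \<noteq> cis (Z (snd p)) \<and> log_chord Z p \<le> ln 2 \<and>
      (1 - t) * log_chord X p + t * log_chord Y p + t * (1 - t) / 8 * (d (fst p) - d (snd p))\<^sup>2 \<le> log_chord Z p"
    using X(1) Y(1) AE_space
  proof eventually_elim
    case (elim p)
    obtain s s' where p: "p = (s, s')" and s: "s \<in> space M" "s' \<in> space M"
      using elim(3) by (auto simp: space_pair_measure)
    \<comment> \<open>The closed windows allow the distance \<open>2 * pi\<close>, but then both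
      angles represent the same point of the circle, which is excluded almost everywhere.\<close>
    have short: "x \<noteq> x' \<and> \<bar>x - x'\<bar> < 2 * pi"
      if "x \<in> {w..w + 2 * pi}" "x' \<in> {w..w + 2 * pi}" "cis x \<noteq> cis x'" for x x' w :: real
    proof -
      have "x \<noteq> x'" "x \<noteq> x' + 2 * pi" "x' \<noteq> x + 2 * pi"
        using that(3) by (auto simp flip: cis_mult)
      with that(1,2) show ?thesis
        by auto
    qed
    have sX: "X s \<noteq> X s'" "\<bar>X s - X s'\<bar> < 2 * pi"
      using short[OF bX[OF s(1)] bX[OF s(2)]] elim(1) by (auto simp: p)
    have sY: "Y s \<noteq> Y s'" "\<bar>Y s - Y s'\<bar> < 2 * pi"
      using short[OF bY[OF s(1)] bY[OF s(2)]] elim(2) by (auto simp: p)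
    \<comment> \<open>Monotonicity only gives a nonnegative product; distinctness of both pairs of
      angles makes it strict.\<close>
    have "(X s - X s') * (Y s - Y s') > 0"
      using mono[OF s] sX(1) sY(1) by (simp add: order.strict_iff_order)
    note * = log_chord_interpolate[OF t this sX(2) sY(2), folded Z_def]
    have ne: "cis (Z s) \<noteq> cis (Z s')"
      using *(1,2) cis_inj_short[of "Z s" "Z s'"] by (auto simp: Z_def)
    moreover have "cmod (cis (Z s) - cis (Z s')) \<le> 2"
      using norm_triangle_ineq4[of "cis (Z s)" "cis (Z s')"] by simp
    ultimately show ?case
      using *(3) by (simp add: p d_def Z_def)
  qed
  then have ne: "AE p in M \<Otimes>\<^sub>M M. cis (Z (fst p)) \<noteq> cis (Z (snd p))"
    and up: "AE p in M \<Otimes>\<^sub>M M. log_chord Z p \<le> ln 2"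
    and low: "AE p in M \<Otimes>\<^sub>M M. (1 - t) * log_chord X p + t * log_chord Y p +
        t * (1 - t) / 8 * (d (fst p) - d (snd p))\<^sup>2 \<le> log_chord Z p"
    by auto
  have "integrable (M \<Otimes>\<^sub>M M) (\<lambda>_. ln 2 :: real)"
  proof -
    interpret pair_prob_space M M ..
    show ?thesis
      by simp
  qed
  \<comment> \<open>The interpolated kernel lies between an integrable lower bound and the constant
    \<open>ln 2\<close>.\<close>
  have iZ: "integrable (M \<Otimes>\<^sub>M M) (log_chord Z)"
  proof (rule Bochner_Integration.integrable_bound)
    show "integrable (M \<Otimes>\<^sub>M M) (\<lambda>p. \<bar>(1 - t) * log_chord X p + t * log_chord Y p +
        t * (1 - t) / 8 * (d (fst p) - d (snd p))\<^sup>2\<bar> + ln 2)"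
      using X(2) Y(2) dd(1) \<open>integrable (M \<Otimes>\<^sub>M M) (\<lambda>_. ln 2 :: real)\<close>
      by (intro Bochner_Integration.integrable_add integrable_abs integrable_mult_right) auto
    have abs_bound: "norm y \<le> norm (\<bar>x\<bar> + ln 2)" if "y \<le> ln 2" "x \<le> y" for x y :: real
    proof -
      have "ln 2 > (0::real)" by simp
      with that show ?thesis
        unfolding real_norm_def by linarith
    qed
    show "AE p in M \<Otimes>\<^sub>M M. norm (log_chord Z p) \<le> norm (\<bar>(1 - t) * log_chord X p + t * log_chord Y p +
        t * (1 - t) / 8 * (d (fst p) - d (snd p))\<^sup>2\<bar> + ln 2)"
      using up low by eventually_elim (rule abs_bound)
  qed measurable
  \<comment> \<open>The factor \<open>1 / 8\<close> turns into \<open>1 / 4\<close> because the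
    double integral of the squared difference is twice the expectation of
    \<open>(d s)\<^sup>2\<close>.\<close>
  have "(1 - t) * (\<integral>p. log_chord X p \<partial>(M \<Otimes>\<^sub>M M)) + t * (\<integral>p. log_chord Y p \<partial>(M \<Otimes>\<^sub>M M)) +
      t * (1 - t) / 4 * expectation (\<lambda>s. (d s)\<^sup>2) =
      (\<integral>p. (1 - t) * log_chord X p + t * log_chord Y p + t * (1 - t) / 8 * (d (fst p) - d (snd p))\<^sup>2 \<partial>(M \<Otimes>\<^sub>M M))"
    using X(2) Y(2) dd by simp
  also have "\<dots> \<le> (\<integral>p. log_chord Z p \<partial>(M \<Otimes>\<^sub>M M))"
    using X(2) Y(2) dd(1) by (intro integral_mono_AE iZ low) auto
  finally have logs: "(1 - t) * (\<integral>p. log_chord X p \<partial>(M \<Otimes>\<^sub>M M)) + t * (\<integral>p. log_chord Y p \<partial>(M \<Otimes>\<^sub>M M)) +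
      t * (1 - t) / 4 * expectation (\<lambda>s. (d s)\<^sup>2) \<le> (\<integral>p. log_chord Z p \<partial>(M \<Otimes>\<^sub>M M))" .

  have iQ: "integrable M (\<lambda>s. Q (cis (W s)))" if [measurable]: "W \<in> borel_measurable M" for W
    using Qb by (intro integrable_const_bound[where B = B]) auto
  have "expectation (\<lambda>s. Q (cis (Z s))) \<le>
      expectation (\<lambda>s. (1 - t) * Q (cis (X s)) + t * Q (cis (Y s)) - t * (1 - t) * ((\<rho> - 1 / 2) / 2) * (d s)\<^sup>2)"
  proof (rule integral_mono)
    show "integrable M (\<lambda>s. Q (cis (Z s)))"
      by (rule iQ) measurable
    show "integrable M (\<lambda>s. (1 - t) * Q (cis (X s)) + t * Q (cis (Y s)) - t * (1 - t) * ((\<rho> - 1 / 2) / 2) * (d s)\<^sup>2)"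
      by (intro Bochner_Integration.integrable_diff Bochner_Integration.integrable_add
          integrable_mult_right iQ id2) measurable
  qed (use potential_interpolate[OF conv t] in \<open>simp add: d_def Z_def\<close>)
  also have "\<dots> = (1 - t) * expectation (\<lambda>s. Q (cis (X s))) + t * expectation (\<lambda>s. Q (cis (Y s))) -
      t * (1 - t) * ((\<rho> - 1 / 2) / 2) * expectation (\<lambda>s. (d s)\<^sup>2)"
    using id2 by (simp add: iQ)
  finally have "expectation (\<lambda>s. Q (cis (Z s))) - (\<integral>p. log_chord Z p \<partial>(M \<Otimes>\<^sub>M M))
      \<le> (1 - t) * a + t * b - \<rho> / 2 * t * (1 - t) * expectation (\<lambda>s. (d s)\<^sup>2)"
    using logs unfolding a b by (simp add: field_simps)
  then show ?thesis
    using log_energy_circle_law[OF \<open>Z \<in> borel_measurable M\<close> assms(3) ne iZ] by (simp add: Z_def d_def)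
qed

end

section \<open>The transport inequality\<close>

abbreviation unit_interval_measure :: "real measure" where
  "unit_interval_measure \<equiv> restrict_space lborel {0<..<1}"

lemma prob_space_unit_interval: "prob_space unit_interval_measure"
  by (auto simp: space_restrict_space emeasure_restrict_space intro!: prob_spaceI)

section \<open>Quantile functions\<close>

lemma quantile_function:
  assumes N: "real_distribution N" and ab: "measure N {a..b} = 1"
  obtains X where "X \<in> borel_measurable unit_interval_measure" "mono_on {0<..<1} X"
    "distr unit_interval_measure borel X = N" "\<And>s. s \<in> {0<..<1} \<Longrightarrow> X s \<in> {a..b}"
proof -
  interpret N: cdf_distribution N
    unfolding cdf_distribution_def by (rule N)
  have range: "N.I s \<in> {a..b}" if s: "s \<in> {0<..<1}" for s
  proof -
    have "measure N {a..b} \<le> measure N {..b}"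
      by (rule N.finite_measure_mono) auto
    then have "s \<le> cdf N b"
      using s ab by (simp add: cdf_def)
    then have "N.I s \<le> b"
      using N.pseudoinverse[of s b] s by simp
    \<comment> \<open>Otherwise \<open>{..N.I s}\<close> and \<open>{a..b}\<close> would be disjoint
      with total mass at least \<open>s + 1\<close>, which exceeds 1.\<close>
    moreover have "\<not> N.I s < a"
    proof
      assume "N.I s < a"
      then have "measure N ({..N.I s} \<union> {a..b}) = measure N {..N.I s} + measure N {a..b}"
        by (intro N.finite_measure_Union) auto
      moreover have "s \<le> measure N {..N.I s}"
        using N.pseudoinverse[of s "N.I s"] s by (simp add: cdf_def)
      ultimately show False
        using s ab N.prob_le_1[of "{..N.I s} \<union> {a..b}"] by simp
    qed
    ultimately show ?thesis
      by simp
  qed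
  have meas: "N.I \<in> borel_measurable unit_interval_measure"
    using N.measurable_CI by (simp add: measurable_def space_restrict_space sets_restrict_space)
  show thesis
    by (rule that[OF meas N.mono_I N.distr_I_eq_M range])
qed

text \<open>One monotone function serves two purposes: its own law is the lift, which governs means
  and transport cost, and its law after \<open>cis\<close> is the circle measure, which governs the
  energy.\<close>

lemma circle_quantile_function:
  assumes \<mu>: "prob_on_circle \<mu>"
  obtains X where "X \<in> borel_measurable unit_interval_measure" "mono_on {0<..<1} X"
    "distr unit_interval_measure borel X = lift_from \<mu> u"
    "distr unit_interval_measure circle_borel (\<lambda>s. cis (X s)) = \<mu>"
    "\<And>s. s \<in> {0<..<1} \<Longrightarrow> X s \<in> {u..u + 2 * pi}"
proof -
  have [measurable_cong]: "sets \<mu> = sets circle_borel"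
    using \<mu> by (simp add: prob_on_circle_def)
  interpret prob_space \<mu>
    using \<mu> by (simp add: prob_on_circle_def)
  have "measure (lift_from \<mu> u) {u..u + 2 * pi} = prob (circle_lift u -` {u..u + 2 * pi} \<inter> space \<mu>)"
    unfolding lift_from_eq_distr[OF \<mu>] by (rule measure_distr) auto
  also have "circle_lift u -` {u..u + 2 * pi} \<inter> space \<mu> = space \<mu>"
    using circle_lift_range[of u] by (auto simp: less_imp_le)
  finally have "measure (lift_from \<mu> u) {u..u + 2 * pi} = 1"
    by (simp add: prob_space)
  from quantile_function[OF real_distribution_lift_from[OF \<mu>] this]
  obtain X where X [measurable]: "X \<in> borel_measurable unit_interval_measure"
    and mono: "mono_on {0<..<1} X"
    and law: "distr unit_interval_measure borel X = lift_from \<mu> u"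
    and range: "\<And>s. s \<in> {0<..<1} \<Longrightarrow> X s \<in> {u..u + 2 * pi}"
    by blast
  have "distr unit_interval_measure circle_borel (cis \<circ> X) =
      distr (distr unit_interval_measure borel X) circle_borel cis"
    by (rule distr_distr[symmetric]) measurable
  also have "\<dots> = \<mu>"
    unfolding law by (rule distr_cis_lift_from[OF \<mu>])
  finally show thesis
    using that[OF X mono law _ range] by (simp add: comp_def)
qed

section \<open>From energy to transport cost\<close>

lemma wasserstein_2_le:
  assumes M: "prob_space M" and [measurable]: "X \<in> borel_measurable M" "Y \<in> borel_measurable M"
    and int: "integrable M (\<lambda>s. (X s - Y s)\<^sup>2)"
  shows "wasserstein 2 (distr M borel X) (distr M borel Y) \<le> ennreal (sqrt (\<integral>s. (X s - Y s)\<^sup>2 \<partial>M))"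
proof -
  let ?D = "\<integral>s. (X s - Y s)\<^sup>2 \<partial>M"
  let ?\<pi> = "distr M (borel \<Otimes>\<^sub>M borel) (\<lambda>s. (X s, Y s))"
  define c where "c = (INF \<pi>\<in>couplings (distr M borel X) (distr M borel Y).
    \<integral>\<^sup>+(x, y). ennreal (\<bar>x - y\<bar> powr 2) \<partial>\<pi>)"
  \<comment> \<open>The joint law of \<open>X\<close> and \<open>Y\<close> is a competitor in the
    infimum, so its cost is an upper bound.\<close>
  have "?\<pi> \<in> couplings (distr M borel X) (distr M borel Y)"
    unfolding couplings_def by (auto simp: distr_distr comp_def)
  then have "c \<le> (\<integral>\<^sup>+(x, y). ennreal (\<bar>x - y\<bar> powr 2) \<partial>?\<pi>)"
    unfolding c_def by (rule INF_lower)
  also have "\<dots> = (\<integral>\<^sup>+s. ennreal ((X s - Y s)\<^sup>2) \<partial>M)"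
    by (subst nn_integral_distr) auto
  also have "\<dots> = ennreal ?D"
    using int by (intro nn_integral_eq_integral) auto
  finally have c: "c \<le> ennreal ?D" .
  \<comment> \<open>Excludes the infinite branch of \<open>ennreal_powr\<close>, so that the root
    can be taken among the reals.\<close>
  then have "c \<noteq> \<top>"
    using neq_top_trans[OF ennreal_neq_top] by blast
  have "enn2real c \<le> ?D"
    using c by (intro enn2real_leI) auto
  then have "enn2real c powr (1 / 2) \<le> sqrt ?D"
    by (simp add: powr_half_sqrt)
  then show ?thesis
    unfolding wasserstein_def ennreal_powr_def c_def[symmetric]
    using \<open>c \<noteq> \<top>\<close> by (auto intro: ennreal_leI)
qed

lemma minimizer_transport_inequality:
  assumes Q: "C_k_on_circle 3 Q" and \<rho>: "\<rho> > 0"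
    and Q2: "\<forall>z\<in>unit_circle. (circle_deriv ^^ 2) Q z \<ge> \<rho> - 1 / 2"
    and min: "energy_minimizer Q \<nu>" and \<mu>: "prob_on_circle \<mu>"
    and e\<mu>: "log_energy Q \<mu> = ereal b" and e\<nu>: "log_energy Q \<nu> = ereal a"
    and means: "(\<integral>x. x \<partial>lift_from \<mu> u) = (\<integral>x. x \<partial>lift_from \<nu> v)"
  shows "wasserstein 2 (lift_from \<mu> u) (lift_from \<nu> v) \<le> ennreal (sqrt (2 * (b - a) / \<rho>))"
proof -
  let ?M = unit_interval_measure
  have \<nu>: "prob_on_circle \<nu>"
    using min by (simp add: energy_minimizer_def)
  obtain X where X [measurable]: "X \<in> borel_measurable ?M" and monoX: "mono_on {0<..<1} X"
    and lawX: "distr ?M borel X = lift_from \<nu> v" "distr ?M circle_borel (\<lambda>s. cis (X s)) = \<nu>"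
    and rX: "\<And>s. s \<in> {0<..<1} \<Longrightarrow> X s \<in> {v..v + 2 * pi}"
    using circle_quantile_function[OF \<nu>, of v] by blast
  obtain Y where Y [measurable]: "Y \<in> borel_measurable ?M" and monoY: "mono_on {0<..<1} Y"
    and lawY: "distr ?M borel Y = lift_from \<mu> u" "distr ?M circle_borel (\<lambda>s. cis (Y s)) = \<mu>"
    and rY: "\<And>s. s \<in> {0<..<1} \<Longrightarrow> Y s \<in> {u..u + 2 * pi}"
    using circle_quantile_function[OF \<mu>, of u] by blast
  interpret prob_space ?M
    by (rule prob_space_unit_interval)
  have space [simp]: "space ?M = {0<..<1}"
    by (simp add: space_restrict_space)
  \<comment> \<open>Both quantile functions are nondecreasing in the same variable, so their
    increments never have opposite signs.\<close>
  have mono: "(X s - X s') * (Y s - Y s') \<ge> 0" if "s \<in> space ?M" "s' \<in> space ?M" for s s'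
  proof (cases "s \<le> s'")
    case True
    have "X s \<le> X s'" "Y s \<le> Y s'"
      using mono_onD[OF monoX, of s s'] mono_onD[OF monoY, of s s'] that True by simp_all
    then show ?thesis
      by (intro mult_nonpos_nonpos) simp_all
  next
    case False
    have "X s' \<le> X s" "Y s' \<le> Y s"
      using mono_onD[OF monoX, of s' s] mono_onD[OF monoY, of s' s] that False by simp_all
    then show ?thesis
      by (intro mult_nonneg_nonneg) simp_all
  qed
  have mean: "expectation X = expectation Y"
  proof -
    have "expectation X = (\<integral>x. x \<partial>lift_from \<nu> v)"
      unfolding lawX(1)[symmetric] by (rule integral_distr[symmetric]) simp_all
    moreover have "expectation Y = (\<integral>x. x \<partial>lift_from \<mu> u)"
      unfolding lawY(1)[symmetric] by (rule integral_distr[symmetric]) simp_all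
    ultimately show ?thesis
      using means by simp
  qed
  obtain B where B: "\<forall>z\<in>unit_circle. \<bar>Q z\<bar> \<le> B"
    using C_k_on_circle_bounded[OF Q] by auto
  have conv: "convex_on UNIV (\<lambda>x. Q (cis x) - (\<rho> - 1 / 2) / 2 * x\<^sup>2)"
    using Q2 by (intro convex_on_potential[OF Q]) auto
  define D where "D = expectation (\<lambda>s. (X s - Y s)\<^sup>2)"
  \<comment> \<open>In the comparison of the minimizer with the interpolated law the energy
    \<open>a\<close> cancels, and every remaining term carries a factor \<open>t\<close> that can be
    divided out.\<close>
  have ineq: "\<rho> / 2 * (1 - t) * D \<le> b - a" if t: "0 < t" "t < 1" for t
  proof -
    have "prob_on_circle (circle_law (\<lambda>s. (1 - t) * X s + t * Y s))"
      by (rule prob_on_circle_law) measurable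
    then have "log_energy Q \<nu> \<le> log_energy Q (circle_law (\<lambda>s. (1 - t) * X s + t * Y s))"
      using min unfolding energy_minimizer_def by blast
    also have "\<dots> \<le> ereal ((1 - t) * a + t * b - \<rho> / 2 * t * (1 - t) * D)"
      unfolding D_def using t B C_k_on_circle_measurable[OF Q] rX rY mono mean conv
      \<comment> \<open>The windows are swapped because the interpolation starts at
        \<open>X\<close>, which represents the minimizer and lives on the window at
        \<open>v\<close>.\<close>
      by (intro log_energy_interpolate[where u = v and v = u and B = B]) (auto simp: lawX lawY e\<mu> e\<nu>)
    finally have "t * (\<rho> / 2 * (1 - t) * D) \<le> t * (b - a)"
      by (simp add: e\<nu> algebra_simps)
    then show ?thesis
      using t by simp
  qed
  \<comment> \<open>Dividing by \<open>t\<close> required \<open>t > 0\<close>; the one-sided limit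
    at 0 removes the factor \<open>1 - t\<close> and gives the sharp constant.\<close>
  have "((\<lambda>t. \<rho> / 2 * (1 - t) * D) \<longlongrightarrow> \<rho> / 2 * (1 - 0) * D) (at_right 0)"
    by (intro tendsto_intros)
  then have "\<rho> / 2 * (1 - 0) * D \<le> b - a"
    by (rule tendsto_upperbound) (use ineq in \<open>auto simp: eventually_at_right_field intro!: exI[of _ 1]\<close>)
  then have D: "D \<le> 2 * (b - a) / \<rho>"
    using \<rho> by (simp add: field_simps)
  have "integrable ?M (\<lambda>s. (Y s - X s)\<^sup>2)"
  proof (rule integrable_const_bound)
    have "(Y s - X s)\<^sup>2 \<le> (\<bar>u - v\<bar> + 2 * pi)\<^sup>2" if "s \<in> {0<..<1}" for s
      using rX[OF that] rY[OF that] by (intro abs_le_square_iff[THEN iffD1]) auto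
    then show "AE s in ?M. norm ((Y s - X s)\<^sup>2) \<le> (\<bar>u - v\<bar> + 2 * pi)\<^sup>2"
      by (intro AE_I2) auto
  qed measurable
  from wasserstein_2_le[OF prob_space_axioms Y X this]
  have "wasserstein 2 (lift_from \<mu> u) (lift_from \<nu> v) \<le> ennreal (sqrt D)"
    by (simp add: lawX lawY D_def power2_commute)
  also have "\<dots> \<le> ennreal (sqrt (2 * (b - a) / \<rho>))"
    using D by (intro ennreal_leI) simp
  finally show ?thesis .
qed

theorem theorem6:
  fixes Q :: "complex \<Rightarrow> real" and \<rho> :: real and \<mu> \<mu>\<^sub>Q :: "complex measure"
  assumes "C_k_on_circle 3 Q"
    and "\<rho> > 0"
    and "\<forall>z\<in>unit_circle. (circle_deriv ^^ 2) Q z \<ge> \<rho> - 1 / 2"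
    and "energy_minimizer Q \<mu>\<^sub>Q"
    and "prob_on_circle \<mu>" and "smooth_measure \<mu>"
  shows "ereal (\<rho> / 2) * enn2ereal ((circle_wasserstein 2 \<mu> \<mu>\<^sub>Q)\<^sup>2)
           \<le> log_energy Q \<mu> - log_energy Q \<mu>\<^sub>Q"
proof (cases "log_energy Q \<mu> = \<infinity>")
  \<comment> \<open>In \<open>ereal\<close>, subtracting anything from \<open>\<infinity>\<close>
    gives \<open>\<infinity>\<close>, so the right-hand side is infinite.\<close>
  case True
  then show ?thesis
    by simp
next
  case False
  note \<mu> = assms(5)
  have \<nu>: "prob_on_circle \<mu>\<^sub>Q" and le: "log_energy Q \<mu>\<^sub>Q \<le> log_energy Q \<mu>"
    using assms(4) \<mu> by (auto simp: energy_minimizer_def)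
  then have fin_Q: "log_energy Q \<mu>\<^sub>Q \<noteq> \<infinity>"
    using False by auto
  \<comment> \<open>Minimality carries finiteness over from \<mu> to \<open>\<mu>\<^sub>Q\<close>,
    so both energies are real numbers.\<close>
  obtain a b where a: "log_energy Q \<mu>\<^sub>Q = ereal a" and b: "log_energy Q \<mu> = ereal b"
    using log_energy_eq[OF \<nu> log_energy_finiteD[OF \<nu> fin_Q]] log_energy_eq[OF \<mu> log_energy_finiteD[OF \<mu> False]]
    by blast
  have "a \<le> b"
    using le by (simp add: a b)
  define k where "k = 2 * (b - a) / \<rho>"
  have k: "k \<ge> 0"
    using \<open>a \<le> b\<close> \<open>\<rho> > 0\<close> by (simp add: k_def)
  define S where "S = {wasserstein 2 (lift_from \<mu> u) (lift_from \<mu>\<^sub>Q v) | u v.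
    u \<in> {0..2 * pi} \<and> v \<in> {0..2 * pi} \<and>
    (\<integral>x. x \<partial>lift_from \<mu> u) = (\<integral>x. x \<partial>lift_from \<mu>\<^sub>Q v)}"
  \<comment> \<open>Without a pair of lifts with equal means the distance would be infinite by
    convention. Smoothness of \<mu> enters here, through the absence of atoms.\<close>
  have "S \<noteq> {}"
    using exists_equal_means[OF \<mu> \<nu> AE_smooth_measure_neq[OF assms(6)]] unfolding S_def by blast
  moreover have "Sup S \<le> ennreal (sqrt k)"
    using minimizer_transport_inequality[OF assms(1-5) b a]
    unfolding S_def k_def by (intro Sup_least) blast
  ultimately have "circle_wasserstein 2 \<mu> \<mu>\<^sub>Q \<le> ennreal (sqrt k)"
    unfolding circle_wasserstein_def Let_def S_def[symmetric] by simp
  then have "(circle_wasserstein 2 \<mu> \<mu>\<^sub>Q)\<^sup>2 \<le> (ennreal (sqrt k))\<^sup>2"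
    by (intro power_mono) auto
  also have "\<dots> = ennreal k"
    using k by (simp add: ennreal_power)
  finally have "enn2ereal ((circle_wasserstein 2 \<mu> \<mu>\<^sub>Q)\<^sup>2) \<le> ereal k"
    using k by (metis enn2ereal_ennreal less_eq_ennreal.rep_eq)
  then have "ereal (\<rho> / 2) * enn2ereal ((circle_wasserstein 2 \<mu> \<mu>\<^sub>Q)\<^sup>2) \<le> ereal (\<rho> / 2) * ereal k"
    using \<open>\<rho> > 0\<close> by (intro ereal_mult_left_mono) auto
  also have "\<dots> = log_energy Q \<mu> - log_energy Q \<mu>\<^sub>Q"
    using \<open>\<rho> > 0\<close> by (simp add: a b k_def)
  finally show ?thesis .
qed

end
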